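(* Let $O\neq I$ be points of a Desargues affine plane, and let $B\in\ell^{OI}$ with $B\neq O$. Then the ratio map $r_B:\ell^{OI}\to\ell^{OI}$, $r_B(X)=r(X:B)=B^{-1}\cdot X$, is a bijection of the line $\ell^{OI}$ onto itself.
   Context: An affine plane consists of a nonempty set of points and a nonempty set of lines (sets of points) such that: any two distinct points $P,Q$ lie on exactly one line $\ell^{PQ}$; for every line $\ell$ and every point $P\notin\ell$ there is exactly one line through $P$ disjoint from $\ell$; and there exist three non-collinear points. Two lines are parallel if they are equal or disjoint. A Desargues affine plane is an affine plane satisfying Desargues' axiom: if $A,B,C,A',B',C'$ are points such that $\ell^{AA'},\ell^{BB'},\ell^{CC'},\ell^{AC},\ell^{A'C'}$ are pairwise distinct lines, $\ell^{AA'},\ell^{BB'},\ell^{CC'}$ are either all parallel or all pass through one common point, $\ell^{AB}\neq\ell^{A'B'}$, $\ell^{BC}\neq\ell^{B'C'}$, $\ell^{AB}\parallel\ell^{A'B'}$ and $\ell^{BC}\parallel\ell^{B'C'}$, then $\ell^{AC}\parallel\ell^{A'C'}$. Fix distinct points $O,I$. For $A,B\in\ell^{OI}$ choose an auxiliary point $B_1\notin\ell^{OI}$. Addition: let $P_1$ be the intersection of the line through $B_1$ parallel to $\ell^{OI}$ with the line through $A$ parallel to $\ell^{OB_1}$; then $A+B$ is the intersection of $\ell^{OI}$ with the line through $P_1$ parallel to $\ell^{BB_1}$. Multiplication: let $P_1$ be the intersection of the line through $A$ parallel to $\ell^{IB_1}$ with $\ell^{OB_1}$; then $A\cdot B$ is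 the intersection of $\ell^{OI}$ with the line through $P_1$ parallel to $\ell^{BB_1}$. It is known that these operations do not depend on $B_1$ and that $(\ell^{OI},+,\cdot)$ is a skew field (division ring) with zero $O$ and identity $I$; inverses are taken in this skew field. For $A,B\in\ell^{OI}$ with $B\neq O$, the ratio of the two points is the point $r(A:B)=B^{-1}\cdot A\in\ell^{OI}$ (also used when $A=B$). *)

theory Defs
  imports "HOL-Algebra.Ring"
begin

text \<open>
  A plane is given by a carrier of points and a set of lines, each line being a set of points.
  The operators below are definite descriptions; they are meaningful only where the described
  object exists uniquely (\<open>P \<noteq> Q\<close> for \<^term>\<open>line_through\<close>, distinct intersecting lines for \<^term>\<open>intersection_point\<close>).
\<close>

definition line_through :: "'p set set \<Rightarrow> 'p \<Rightarrow> 'p \<Rightarrow> 'p set" where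
  "line_through lines P Q = (THE l. l \<in> lines \<and> P \<in> l \<and> Q \<in> l)"

definition intersection_point :: "'p set \<Rightarrow> 'p set \<Rightarrow> 'p" where
  "intersection_point l m = (THE P. P \<in> l \<and> P \<in> m)"

definition parallel :: "'p set \<Rightarrow> 'p set \<Rightarrow> bool" where
  "parallel l m \<longleftrightarrow> l = m \<or> l \<inter> m = {}"

definition parallel_through :: "'p set set \<Rightarrow> 'p \<Rightarrow> 'p set \<Rightarrow> 'p set" where
  "parallel_through lines P l = (THE m. m \<in> lines \<and> P \<in> m \<and> parallel m l)"

locale affine_plane =
  fixes points :: "'p set" and lines :: "'p set set"
  assumes points_nonempty: "points \<noteq> {}"
    and lines_nonempty: "lines \<noteq> {}"
    and line_subset: "l \<in> lines \<Longrightarrow> l \<subseteq> points"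
    and unique_line:
      "\<lbrakk>P \<in> points; Q \<in> points; P \<noteq> Q\<rbrakk> \<Longrightarrow> \<exists>!l. l \<in> lines \<and> P \<in> l \<and> Q \<in> l"
    and unique_disjoint_line:
      "\<lbrakk>l \<in> lines; P \<in> points; P \<notin> l\<rbrakk> \<Longrightarrow> \<exists>!m. m \<in> lines \<and> P \<in> m \<and> m \<inter> l = {}"
    and noncollinear_points:
      "\<exists>P\<in>points. \<exists>Q\<in>points. \<exists>R\<in>points.
         distinct [P, Q, R] \<and> (\<nexists>l. l \<in> lines \<and> P \<in> l \<and> Q \<in> l \<and> R \<in> l)"

text \<open>
  The inequalities between points in Desargues' axiom only ensure that the lines
  mentioned are well defined.
\<close>

locale desargues_affine_plane = affine_plane +
  assumes desargues:
    "\<lbrakk>{A, B, C, A', B', C'} \<subseteq> points;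
      A \<noteq> A'; B \<noteq> B'; C \<noteq> C'; A \<noteq> B; A' \<noteq> B'; B \<noteq> C; B' \<noteq> C'; A \<noteq> C; A' \<noteq> C';
      distinct [line_through lines A A', line_through lines B B', line_through lines C C',
                line_through lines A C, line_through lines A' C'];
      (parallel (line_through lines A A') (line_through lines B B') \<and>
       parallel (line_through lines B B') (line_through lines C C') \<and>
       parallel (line_through lines A A') (line_through lines C C')) \<or>
      (\<exists>P\<in>points. P \<in> line_through lines A A' \<and> P \<in> line_through lines B B' \<and>
         P \<in> line_through lines C C');
      line_through lines A B \<noteq> line_through lines A' B'; line_through lines B C \<noteq> line_through lines B' C';
      parallel (line_through lines A B) (line_through lines A' B');
      parallel (line_through lines B C) (line_through lines B' C')\<rbrakk>
     \<Longrightarrow> parallel (line_through lines A C) (line_through lines A' C')"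

text \<open>
  Coordinate operations on the line joining the zero point \<open>Z\<close> and the unit point \<open>I\<close>, first
  relative to an auxiliary point \<open>B\<^sub>1\<close> off that line, then as the common value over all
  auxiliary points.
\<close>

definition add_via :: "'p set set \<Rightarrow> 'p \<Rightarrow> 'p \<Rightarrow> 'p \<Rightarrow> 'p \<Rightarrow> 'p \<Rightarrow> 'p" where
  "add_via lines Z I B\<^sub>1 A B =
    (let P\<^sub>1 = intersection_point (parallel_through lines B\<^sub>1 (line_through lines Z I))
                   (parallel_through lines A (line_through lines Z B\<^sub>1))
     in intersection_point (line_through lines Z I) (parallel_through lines P\<^sub>1 (line_through lines B B\<^sub>1)))"

definition mult_via :: "'p set set \<Rightarrow> 'p \<Rightarrow> 'p \<Rightarrow> 'p \<Rightarrow> 'p \<Rightarrow> 'p \<Rightarrow> 'p" where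
  "mult_via lines Z I B\<^sub>1 A B =
    (let P\<^sub>1 = intersection_point (parallel_through lines A (line_through lines I B\<^sub>1)) (line_through lines Z B\<^sub>1)
     in intersection_point (line_through lines Z I) (parallel_through lines P\<^sub>1 (line_through lines B B\<^sub>1)))"

definition point_add :: "'p set \<Rightarrow> 'p set set \<Rightarrow> 'p \<Rightarrow> 'p \<Rightarrow> 'p \<Rightarrow> 'p \<Rightarrow> 'p" where
  "point_add points lines Z I A B =
    (THE C. \<exists>B\<^sub>1\<in>points - line_through lines Z I. C = add_via lines Z I B\<^sub>1 A B)"

definition point_mult :: "'p set \<Rightarrow> 'p set set \<Rightarrow> 'p \<Rightarrow> 'p \<Rightarrow> 'p \<Rightarrow> 'p \<Rightarrow> 'p" where
  "point_mult points lines Z I A B =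
    (THE C. \<exists>B\<^sub>1\<in>points - line_through lines Z I. C = mult_via lines Z I B\<^sub>1 A B)"

definition line_ring :: "'p set \<Rightarrow> 'p set set \<Rightarrow> 'p \<Rightarrow> 'p \<Rightarrow> 'p ring" where
  "line_ring points lines Z I =
    \<lparr>carrier = line_through lines Z I,
     mult = point_mult points lines Z I, one = I,
     zero = Z, add = point_add points lines Z I\<rparr>"

definition ratio :: "'p set \<Rightarrow> 'p set set \<Rightarrow> 'p \<Rightarrow> 'p \<Rightarrow> 'p \<Rightarrow> 'p \<Rightarrow> 'p" where
  "ratio points lines Z I A B =
    inv\<^bsub>line_ring points lines Z I\<^esub> B \<otimes>\<^bsub>line_ring points lines Z I\<^esub> A"

end

theory Submission
  imports Defs
begin

text \<open>
  Left multiplication by a point \<open>A \<noteq> Z\<close>, computed with a fixed auxiliary point \<open>B\<^sub>1\<close>, sends \<open>X\<close>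
  to the trace on the line \<open>ZI\<close> of the parallel to \<open>XB\<^sub>1\<close> through a fixed point \<open>P\<close>, hence is
  bijective. Two applications of Desargues' axiom with centre \<open>Z\<close> make it independent of
  \<open>B\<^sub>1\<close>. If \<open>B \<cdot> Y = I\<close> is computed with \<open>B\<^sub>1\<close> and the intermediate point is \<open>P\<close>, the same figure read
  with \<open>P\<close> as auxiliary point and \<open>B\<^sub>1\<close> as intermediate point says \<open>Y \<cdot> B = I\<close>. So inverses
  exist without associativity, and the ratio map is left multiplication by an inverse.
\<close>

section \<open>Parallels, joins and intersections in an affine plane\<close>

lemma parallel_refl [simp]: "parallel l l"
  by (simp add: parallel_def)

lemma parallel_sym: "parallel l m \<Longrightarrow> parallel m l"
  by (auto simp: parallel_def)

lemma parallel_meet_eq: "\<lbrakk>parallel l m; P \<in> l; P \<in> m\<rbrakk> \<Longrightarrow> l = m"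
  by (auto simp: parallel_def)

lemma line_through_commute: "line_through lines P Q = line_through lines Q P"
  unfolding line_through_def by metis

context affine_plane
begin

abbreviation join :: "'p \<Rightarrow> 'p \<Rightarrow> 'p set" where
  "join \<equiv> line_through lines"

lemma point_of_line: "\<lbrakk>l \<in> lines; P \<in> l\<rbrakk> \<Longrightarrow> P \<in> points"
  using line_subset by blast

lemma
  assumes "P \<in> points" "Q \<in> points" "P \<noteq> Q"
  shows join_line: "join P Q \<in> lines"
    and join_left: "P \<in> join P Q"
    and join_right: "Q \<in> join P Q"
  using theI'[OF unique_line[OF assms]] by (auto simp: line_through_def)

lemma line_eqI:
  assumes "l \<in> lines" "m \<in> lines" "P \<in> l" "Q \<in> l" "P \<in> m" "Q \<in> m" "P \<noteq> Q"
  shows "l = m"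
  using unique_line[of P Q] assms point_of_line by blast

lemma join_eqI:
  assumes "l \<in> lines" "P \<in> l" "Q \<in> l" "P \<noteq> Q"
  shows "join P Q = l"
  by (meson assms line_eqI join_line join_left join_right point_of_line)

lemma intersection_point_eqI:
  assumes "l \<in> lines" "m \<in> lines" "l \<noteq> m" "P \<in> l" "P \<in> m"
  shows "intersection_point l m = P"
  unfolding intersection_point_def using assms line_eqI by (intro the_equality) blast+

text \<open>A common point of distinct \<open>l\<close> and \<open>n\<close> would lie off
  \<open>m\<close> and carry two different lines disjoint from \<open>m\<close>.\<close>

lemma parallel_trans:
  assumes "l \<in> lines" "m \<in> lines" "n \<in> lines" "parallel l m" "parallel m n"
  shows "parallel l n"
proof (rule ccontr)
  assume np: "\<not> parallel l n"
  then obtain P where P: "P \<in> l" "P \<in> n" "l \<noteq> n"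
    by (auto simp: parallel_def)
  then have "l \<inter> m = {}" "n \<inter> m = {}"
    using assms np by (auto simp: parallel_def)
  moreover from this P have "P \<notin> m" by auto
  ultimately show False
    using unique_disjoint_line[OF assms(2), of P] P assms point_of_line by blast
qed

lemma parallel_through_ex1:
  assumes "l \<in> lines" "P \<in> points"
  shows "\<exists>!m. m \<in> lines \<and> P \<in> m \<and> parallel m l"
proof (cases "P \<in> l")
  case True
  then show ?thesis
    using assms(1) parallel_meet_eq parallel_refl by metis
next
  case False
  then show ?thesis
    using unique_disjoint_line[OF assms False] unfolding parallel_def by metis
qed

lemma
  assumes "l \<in> lines" "P \<in> points"
  shows parallel_through_line: "parallel_through lines P l \<in> lines"
    and parallel_through_incident: "P \<in> parallel_through lines P l"
    and parallel_through_parallel: "parallel (parallel_through lines P l) l"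
  using theI'[OF parallel_through_ex1[OF assms]] by (auto simp: parallel_through_def)

lemma parallel_through_eqI:
  assumes "l \<in> lines" "m \<in> lines" "P \<in> m" "parallel m l"
  shows "parallel_through lines P l = m"
  unfolding parallel_through_def
  using parallel_through_ex1[OF assms(1), of P] assms point_of_line
  by (intro the1_equality) auto

lemma ex_point_off_line:
  assumes "l \<in> lines"
  shows "\<exists>P\<in>points. P \<notin> l"
  using noncollinear_points assms by blast

text \<open>\<open>D\<close> is the fourth vertex of the parallelogram with sides \<open>QR\<close>
  and \<open>QS\<close>. It will serve as a detour between two auxiliary points that are collinear
  with the zero point.\<close>

lemma ex_point_off_joins:
  assumes "Q \<in> points" "R \<in> points" "S \<in> points" "Q \<noteq> R" "S \<notin> join Q R"
  shows "\<exists>D\<in>points. D \<notin> join Q R \<and> D \<notin> join Q S"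
proof -
  have ne: "Q \<noteq> S" using assms join_left by blast
  define l where "l = parallel_through lines S (join Q R)"
  define m where "m = parallel_through lines R (join Q S)"
  have l: "l \<in> lines" "S \<in> l" "parallel l (join Q R)"
    using assms unfolding l_def
    by (simp_all add: parallel_through_line parallel_through_incident parallel_through_parallel join_line)
  have m: "m \<in> lines" "R \<in> m" "parallel m (join Q S)"
    using assms ne unfolding m_def
    by (simp_all add: parallel_through_line parallel_through_incident parallel_through_parallel join_line)
  note QR = join_line[OF assms(1,2,4)] join_left[OF assms(1,2,4)] join_right[OF assms(1,2,4)]
  note QS = join_line[OF assms(1,3) ne] join_left[OF assms(1,3) ne] join_right[OF assms(1,3) ne]
  have neq: "join Q R \<noteq> join Q S" using QS assms(5) by auto
  have "\<not> parallel l m"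
  proof
    assume "parallel l m"
    then have "parallel (join Q R) (join Q S)"
      using l m QR QS parallel_trans parallel_sym by metis
    then show False using parallel_meet_eq QR(2) QS(2) neq by metis
  qed
  then obtain D where D: "D \<in> l" "D \<in> m" by (auto simp: parallel_def)
  have "D \<notin> join Q R" using parallel_meet_eq[OF l(3) D(1)] l(2) assms(5) by blast
  moreover have "D \<notin> join Q S"
  proof
    assume "D \<in> join Q S"
    then have "R \<in> join Q S" using parallel_meet_eq[OF m(3) D(2)] m(2) by blast
    then show False using line_eqI[OF QR(1) QS(1)] QR QS neq assms(4) by blast
  qed
  ultimately show ?thesis using D l point_of_line by blast
qed

lemma concurrent_distinct:
  assumes "a \<in> lines" "b \<in> lines" "a \<noteq> b" "Z \<in> a" "Z \<in> b" "A \<in> a" "A \<noteq> Z"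
  shows "A \<notin> b"
  using assms line_eqI by blast

text \<open>Parallel lines through \<open>A\<close> coincide, so \<open>B \<noteq> B'\<close> would
  make this line equal to \<open>b\<close>, which avoids \<open>A\<close>. This settles the
  degenerate cases of Desargues' axiom.\<close>

lemma parallel_joins_eq:
  assumes "a \<in> lines" "b \<in> lines" "a \<noteq> b" "Z \<in> a" "Z \<in> b"
    and "A \<in> a" "A \<noteq> Z" "B \<in> b" "B' \<in> b"
    and "parallel (join A B) (join A B')"
  shows "B = B'"
proof (rule ccontr)
  assume ne: "B \<noteq> B'"
  have A: "A \<notin> b" using assms concurrent_distinct by blast
  have pts: "A \<in> points" "B \<in> points" "B' \<in> points" "A \<noteq> B" "A \<noteq> B'"
    using assms A point_of_line by blast+
  then have "join A B = join A B'"
    using parallel_meet_eq[OF assms(10)] join_left by blast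
  then have "b = join A B"
    using line_eqI[of b "join A B" B B'] pts assms ne join_line join_right by metis
  then show False using A pts join_left by metis
qed

end

section \<open>Desargues' axiom for two triangles in perspective from a point\<close>

context desargues_affine_plane
begin

text \<open>The concurrent case of the axiom, freed from most of its nondegeneracy conditions. If
  one pair of corresponding vertices coincides, so do the others and the claim is trivial; if none
  does, all the required inequalities follow from the three lines meeting only in
  \<open>Z\<close>.\<close>

lemma central_desargues:
  assumes lines: "a \<in> lines" "b \<in> lines" "c \<in> lines"
    and distinct: "a \<noteq> b" "b \<noteq> c" "a \<noteq> c"
    and center: "Z \<in> a" "Z \<in> b" "Z \<in> c"
    and A: "A \<in> a" "A' \<in> a" "A \<noteq> Z" "A' \<noteq> Z"
    and B: "B \<in> b" "B' \<in> b" "B \<noteq> Z" "B' \<noteq> Z"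
    and C: "C \<in> c" "C' \<in> c" "C \<noteq> Z" "C' \<noteq> Z"
    and AB: "parallel (join A B) (join A' B')"
    and BC: "parallel (join B C) (join B' C')"
  shows "parallel (join A C) (join A' C')"
proof (cases "A = A'")
  case True
  then have "B = B'"
    using parallel_joins_eq[of a b Z A B B'] assms by simp
  then have "C = C'"
    using parallel_joins_eq[of b c Z B C C'] assms by simp
  then show ?thesis using True by simp
next
  case AA: False
  have BB: "B \<noteq> B'"
  proof
    assume "B = B'"
    then have "A = A'"
      using parallel_joins_eq[of b a Z B A A'] assms line_through_commute[of lines] by simp
    with AA show False ..
  qed
  have CC: "C \<noteq> C'"
  proof
    assume "C = C'"
    then have "B = B'"
      using parallel_joins_eq[of c b Z C B B'] assms line_through_commute[of lines] by simp
    with BB show False ..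
  qed
  note off =
    concurrent_distinct[OF lines(1,2) distinct(1) center(1,2) A(1,3)]
    concurrent_distinct[OF lines(1,2) distinct(1) center(1,2) A(2,4)]
    concurrent_distinct[OF lines(1,3) distinct(3) center(1,3) A(1,3)]
    concurrent_distinct[OF lines(1,3) distinct(3) center(1,3) A(2,4)]
    concurrent_distinct[OF lines(2,1) distinct(1)[symmetric] center(2,1) B(1,3)]
    concurrent_distinct[OF lines(2,1) distinct(1)[symmetric] center(2,1) B(2,4)]
    concurrent_distinct[OF lines(2,3) distinct(2) center(2,3) B(1,3)]
    concurrent_distinct[OF lines(2,3) distinct(2) center(2,3) B(2,4)]
    concurrent_distinct[OF lines(3,1) distinct(3)[symmetric] center(3,1) C(1,3)]
    concurrent_distinct[OF lines(3,1) distinct(3)[symmetric] center(3,1) C(2,4)]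
    concurrent_distinct[OF lines(3,2) distinct(2)[symmetric] center(3,2) C(1,3)]
    concurrent_distinct[OF lines(3,2) distinct(2)[symmetric] center(3,2) C(2,4)]
  have ne: "A \<noteq> B" "A' \<noteq> B'" "B \<noteq> C" "B' \<noteq> C'" "A \<noteq> C" "A' \<noteq> C'"
    using off A B C by auto
  have pts: "A \<in> points" "A' \<in> points" "B \<in> points" "B' \<in> points" "C \<in> points" "C' \<in> points"
    "Z \<in> points"
    using assms point_of_line by blast+
  have joins: "join A A' = a" "join B B' = b" "join C C' = c"
    using join_eqI lines A B C AA BB CC by auto
  have inc: "A \<in> join A B" "A' \<in> join A' B'" "B \<in> join B C" "B' \<in> join B' C'"
    "A \<in> join A C" "A' \<in> join A' C'" "B \<in> join A B" "B' \<in> join A' B'" "C \<in> join B C"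
    "C' \<in> join B' C'" "C \<in> join A C" "C' \<in> join A' C'"
    using pts ne join_left join_right by auto
  have ln: "join A B \<in> lines" "join B C \<in> lines" "join A C \<in> lines"
    using pts ne join_line by auto
  \<comment> \<open>A common side line would contain both \<open>A\<close> and \<open>A'\<close>,
    hence be \<open>a\<close>, which avoids \<open>B\<close>. The next two inequalities are
    analogous.\<close>
  have neAB: "join A B \<noteq> join A' B'"
    using line_eqI[OF ln(1) lines(1)] inc A AA off by metis
  have neBC: "join B C \<noteq> join B' C'"
    using line_eqI[OF ln(2) lines(2)] inc B BB off by metis
  have neAC: "join A C \<noteq> join A' C'"
    using line_eqI[OF ln(3) lines(1)] inc A AA off by metis
  have sides: "join A C \<notin> {a, b, c}" "join A' C' \<notin> {a, b, c}"
    using inc off by auto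
  show ?thesis
  proof (rule desargues[OF _ AA BB CC ne _ _ neAB neBC AB BC])
    show "{A, B, C, A', B', C'} \<subseteq> points" using pts by simp
    show "distinct [join A A', join B B', join C C', join A C, join A' C']"
      using sides neAC distinct unfolding joins by (simp add: eq_commute)
    have "\<exists>P\<in>points. P \<in> join A A' \<and> P \<in> join B B' \<and> P \<in> join C C'"
      unfolding joins using center pts(7) by blast
    then show "(parallel (join A A') (join B B') \<and> parallel (join B B') (join C C') \<and>
        parallel (join A A') (join C C')) \<or>
      (\<exists>P\<in>points. P \<in> join A A' \<and> P \<in> join B B' \<and> P \<in> join C C')" ..
  qed
qed

end

section \<open>The coordinate line and the figure that defines its multiplication\<close>

locale desargues_frame = desargues_affine_plane points lines
  for points :: "'p set" and lines :: "'p set set" +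
  fixes Z I :: 'p
  assumes Z_point: "Z \<in> points" and I_point: "I \<in> points" and Z_neq_I: "Z \<noteq> I"
begin

abbreviation axis :: "'p set" where
  "axis \<equiv> join Z I"

lemmas axis_line = join_line[OF Z_point I_point Z_neq_I]
  and Z_axis = join_left[OF Z_point I_point Z_neq_I]
  and I_axis = join_right[OF Z_point I_point Z_neq_I]

lemma axis_point: "A \<in> axis \<Longrightarrow> A \<in> points"
  using point_of_line axis_line by blast

lemma
  assumes "B\<^sub>1 \<in> points" "B\<^sub>1 \<notin> axis" "A \<in> axis"
  shows off_axis_join_line: "join A B\<^sub>1 \<in> lines"
    and off_axis_join_left: "A \<in> join A B\<^sub>1"
    and off_axis_join_right: "B\<^sub>1 \<in> join A B\<^sub>1"
    and off_axis_join_neq: "join A B\<^sub>1 \<noteq> axis"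
proof -
  have ne: "A \<noteq> B\<^sub>1" using assms by auto
  show "join A B\<^sub>1 \<in> lines" "A \<in> join A B\<^sub>1" "B\<^sub>1 \<in> join A B\<^sub>1"
    using join_line join_left join_right axis_point assms ne by blast+
  then show "join A B\<^sub>1 \<noteq> axis" using assms by auto
qed

lemmas off_axis = off_axis_join_line off_axis_join_left off_axis_join_right

lemma off_axis_meet:
  assumes "B\<^sub>1 \<in> points" "B\<^sub>1 \<notin> axis" "A \<in> axis" "A' \<in> axis" "A' \<in> join A B\<^sub>1"
  shows "A' = A"
  using line_eqI[OF off_axis_join_line axis_line] off_axis_join_neq off_axis_join_left assms
  by metis

lemma off_axis_parallel_eq:
  assumes "B\<^sub>1 \<in> points" "B\<^sub>1 \<notin> axis" "A \<in> axis" "A' \<in> axis"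
    and par: "parallel (join A B\<^sub>1) (join A' B\<^sub>1)"
  shows "A = A'"
  using parallel_meet_eq[OF par, of B\<^sub>1] off_axis_meet[OF assms(1,2,4,3)]
    off_axis[OF assms(1,2,3)] off_axis[OF assms(1,2,4)] by simp

text \<open>Otherwise transitivity would make the axis parallel to \<open>join A B\<^sub>1\<close>,
  a different line through \<open>A\<close>.\<close>

lemma parallel_off_axis_meets:
  assumes "B\<^sub>1 \<in> points" "B\<^sub>1 \<notin> axis" "A \<in> axis" "m \<in> lines" "parallel m (join A B\<^sub>1)"
  shows "\<exists>X. X \<in> axis \<and> X \<in> m"
proof (rule ccontr)
  assume "\<nexists>X. X \<in> axis \<and> X \<in> m"
  then have "parallel axis m" by (auto simp: parallel_def)
  then have "parallel axis (join A B\<^sub>1)"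
    using parallel_trans assms axis_line off_axis_join_line by blast
  then show False
    using parallel_meet_eq assms off_axis_join_left off_axis_join_neq by metis
qed

text \<open>The figure of \<open>mult_via\<close> as a relation: \<open>P\<close> is its
  intermediate point and \<open>X\<close> its result. Stating it by parallel joins lets it be solved
  for \<open>B\<close> as well as for \<open>X\<close>, and lets \<open>P\<close> and
  \<open>B\<^sub>1\<close> change roles. With \<open>B\<^sub>1\<close> off the axis and
  \<open>A\<close> on it, the condition \<open>P \<notin> axis\<close> forces
  \<open>A \<noteq> Z\<close>.\<close>

definition mult_config :: "'p \<Rightarrow> 'p \<Rightarrow> 'p \<Rightarrow> 'p \<Rightarrow> 'p \<Rightarrow> bool" where
  "mult_config B\<^sub>1 A B P X \<longleftrightarrow>
     P \<in> join Z B\<^sub>1 \<and> P \<notin> axis \<and> X \<in> axis \<and>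
     parallel (join A P) (join I B\<^sub>1) \<and> parallel (join X P) (join B B\<^sub>1)"

lemma mult_config_point:
  assumes "B\<^sub>1 \<in> points" "B\<^sub>1 \<notin> axis" "mult_config B\<^sub>1 A B P X"
  shows "P \<in> points" "P \<notin> axis" "P \<noteq> Z"
  using assms point_of_line[OF off_axis_join_line[OF assms(1,2) Z_axis], of P] Z_axis
  by (auto simp: mult_config_def)

lemma mult_via_eq:
  assumes B1: "B\<^sub>1 \<in> points" "B\<^sub>1 \<notin> axis" and "A \<in> axis" "B \<in> axis"
    and cfg: "mult_config B\<^sub>1 A B P X"
  shows "mult_via lines Z I B\<^sub>1 A B = X"
proof -
  note P = mult_config_point[OF B1 cfg]
  have X: "X \<in> axis" and par: "parallel (join A P) (join I B\<^sub>1)" "parallel (join X P) (join B B\<^sub>1)"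
    and PZ: "P \<in> join Z B\<^sub>1"
    using cfg by (auto simp: mult_config_def)
  have AP: "parallel_through lines A (join I B\<^sub>1) = join A P"
    using off_axis[OF P(1,2) assms(3)] off_axis[OF B1 I_axis] par by (intro parallel_through_eqI)
  have neq: "join A P \<noteq> join Z B\<^sub>1"
  proof
    assume eq: "join A P = join Z B\<^sub>1"
    then have "parallel (join Z B\<^sub>1) (join I B\<^sub>1)" using par by simp
    then show False using off_axis_parallel_eq[OF B1 Z_axis I_axis] Z_neq_I by blast
  qed
  have P_eq: "intersection_point (join A P) (join Z B\<^sub>1) = P"
    using off_axis[OF P(1,2) assms(3)] off_axis[OF B1 Z_axis] PZ neq
    by (intro intersection_point_eqI)
  have XP: "parallel_through lines P (join B B\<^sub>1) = join X P"
    using off_axis[OF P(1,2) X] off_axis[OF B1 assms(4)] par by (intro parallel_through_eqI)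
  have "intersection_point axis (join X P) = X"
    using off_axis[OF P(1,2) X] off_axis_join_neq[OF P(1,2) X] axis_line X
    by (intro intersection_point_eqI) auto
  then show ?thesis
    by (simp add: mult_via_def AP P_eq XP)
qed

text \<open>The parallel to \<open>IB\<^sub>1\<close> through \<open>A\<close> meets
  \<open>ZB\<^sub>1\<close> because \<open>IB\<^sub>1\<close> and \<open>ZB\<^sub>1\<close> are not
  parallel. A meeting point on the axis could only be \<open>Z\<close>, and since
  \<open>A \<noteq> Z\<close> the parallel would then be the axis itself.\<close>

lemma ex_mult_config_foot:
  assumes B1: "B\<^sub>1 \<in> points" "B\<^sub>1 \<notin> axis" and A: "A \<in> axis" "A \<noteq> Z"
  shows "\<exists>P\<in>points. P \<in> join Z B\<^sub>1 \<and> P \<notin> axis \<and> parallel (join A P) (join I B\<^sub>1)"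
proof -
  define p where "p = parallel_through lines A (join I B\<^sub>1)"
  note IB = off_axis[OF B1 I_axis] and ZB = off_axis[OF B1 Z_axis]
  have p: "p \<in> lines" "A \<in> p" "parallel p (join I B\<^sub>1)"
    using A axis_point IB unfolding p_def
    by (simp_all add: parallel_through_line parallel_through_incident parallel_through_parallel)
  have "\<not> parallel (join Z B\<^sub>1) p"
  proof
    assume "parallel (join Z B\<^sub>1) p"
    then have "parallel (join Z B\<^sub>1) (join I B\<^sub>1)"
      using parallel_trans[OF ZB(1) p(1) IB(1)] p(3) by blast
    then show False using off_axis_parallel_eq[OF B1 Z_axis I_axis] Z_neq_I by blast
  qed
  then obtain P where P: "P \<in> join Z B\<^sub>1" "P \<in> p" by (auto simp: parallel_def)
  have "P \<notin> axis"
  proof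
    assume "P \<in> axis"
    then have "P = Z" using off_axis_meet[OF B1 Z_axis] P by blast
    then have "p = axis" using line_eqI[OF p(1) axis_line] p P A Z_axis by metis
    then show False using p parallel_meet_eq I_axis IB B1 by metis
  qed
  moreover from this have "join A P = p" using P p A by (intro join_eqI) auto
  ultimately show ?thesis using P p point_of_line by blast
qed

lemma ex_mult_config:
  assumes B1: "B\<^sub>1 \<in> points" "B\<^sub>1 \<notin> axis" and A: "A \<in> axis" "A \<noteq> Z" and B: "B \<in> axis"
  shows "\<exists>P X. mult_config B\<^sub>1 A B P X"
proof -
  obtain P where P: "P \<in> points" "P \<in> join Z B\<^sub>1" "P \<notin> axis" "parallel (join A P) (join I B\<^sub>1)"
    using ex_mult_config_foot[OF B1 A] by blast
  define q where "q = parallel_through lines P (join B B\<^sub>1)"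
  have q: "q \<in> lines" "P \<in> q" "parallel q (join B B\<^sub>1)"
    using P off_axis[OF B1 B] unfolding q_def
    by (simp_all add: parallel_through_line parallel_through_incident parallel_through_parallel)
  obtain X where X: "X \<in> axis" "X \<in> q"
    using parallel_off_axis_meets[OF B1 B q(1,3)] by blast
  have "join X P = q" using X q P by (intro join_eqI) auto
  then show ?thesis using P X q by (auto simp: mult_config_def)
qed

text \<open>The figure run backwards: \<open>P\<close> depends only on \<open>A\<close> and
  \<open>B\<^sub>1\<close>, so a prescribed product \<open>X\<close> gives \<open>B\<close> as the
  trace on the axis of the parallel to \<open>XP\<close> through \<open>B\<^sub>1\<close>. This
  yields both surjectivity and inverses.\<close>

lemma ex_mult_config_factor:
  assumes B1: "B\<^sub>1 \<in> points" "B\<^sub>1 \<notin> axis" and A: "A \<in> axis" "A \<noteq> Z" and X: "X \<in> axis"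
  shows "\<exists>P B. B \<in> axis \<and> mult_config B\<^sub>1 A B P X"
proof -
  obtain P where P: "P \<in> points" "P \<in> join Z B\<^sub>1" "P \<notin> axis" "parallel (join A P) (join I B\<^sub>1)"
    using ex_mult_config_foot[OF B1 A] by blast
  define q where "q = parallel_through lines B\<^sub>1 (join X P)"
  have q: "q \<in> lines" "B\<^sub>1 \<in> q" "parallel q (join X P)"
    using B1 off_axis[OF P(1,3) X] unfolding q_def
    by (simp_all add: parallel_through_line parallel_through_incident parallel_through_parallel)
  obtain B where B: "B \<in> axis" "B \<in> q"
    using parallel_off_axis_meets[OF P(1,3) X q(1,3)] by blast
  have "join B B\<^sub>1 = q" using B q B1 by (intro join_eqI) auto
  then show ?thesis using P X B q parallel_sym by (auto simp: mult_config_def)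
qed

section \<open>Independence of the product from the auxiliary point\<close>

lemma mult_config_transfer_generic:
  assumes B1: "B\<^sub>1 \<in> points" "B\<^sub>1 \<notin> axis" and C1: "C\<^sub>1 \<in> points" "C\<^sub>1 \<notin> axis" "C\<^sub>1 \<notin> join Z B\<^sub>1"
    and A: "A \<in> axis" "A \<noteq> Z" and B: "B \<in> axis"
    and cfg: "mult_config B\<^sub>1 A B P X"
  shows "\<exists>Q. mult_config C\<^sub>1 A B Q X"
proof -
  note P = mult_config_point[OF B1 cfg]
  have X: "X \<in> axis" and par: "parallel (join A P) (join I B\<^sub>1)" "parallel (join X P) (join B B\<^sub>1)"
    and PZ: "P \<in> join Z B\<^sub>1"
    using cfg by (auto simp: mult_config_def)
  obtain Q where Q: "Q \<in> points" "Q \<in> join Z C\<^sub>1" "Q \<notin> axis" "parallel (join A Q) (join I C\<^sub>1)"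
    using ex_mult_config_foot[OF C1(1,2) A] by blast
  note ZB = off_axis[OF B1 Z_axis] and ZC = off_axis[OF C1(1,2) Z_axis]
  have neq: "join Z B\<^sub>1 \<noteq> axis" "join Z C\<^sub>1 \<noteq> axis" "join Z B\<^sub>1 \<noteq> join Z C\<^sub>1"
    using ZB ZC B1 C1 by auto
  have nZ: "B\<^sub>1 \<noteq> Z" "C\<^sub>1 \<noteq> Z" "Q \<noteq> Z" using B1 C1 Q Z_axis by auto
  \<comment> \<open>Desargues needs vertices different from the centre, so the case of a zero factor
    is split off; there the product is zero too.\<close>
  have ZX: "X = Z \<longleftrightarrow> B = Z"
  proof
    assume "X = Z"
    then have "join X P = join Z B\<^sub>1" using join_eqI[of "join Z B\<^sub>1" Z P] ZB PZ P by auto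
    then show "B = Z" using par off_axis_parallel_eq[OF B1 Z_axis B] by simp
  next
    assume "B = Z"
    then have "join X P = join Z B\<^sub>1"
      using parallel_meet_eq[OF par(2), of P] PZ off_axis[OF P(1,2) X] by simp
    then show "X = Z" using off_axis_meet[OF B1 Z_axis X] off_axis[OF P(1,2) X] by auto
  qed
  have "parallel (join X Q) (join B C\<^sub>1)"
  proof (cases "B = Z")
    case True
    then have "X = Z" using ZX by simp
    then have "join X Q = join Z C\<^sub>1" using join_eqI[of "join Z C\<^sub>1" Z Q] ZC Q nZ by auto
    then show ?thesis using True by simp
  next
    case False
    \<comment> \<open>First application: triangles \<open>P, A, Q\<close> and
      \<open>B\<^sub>1, I, C\<^sub>1\<close>.\<close>
    have PQ: "parallel (join P Q) (join B\<^sub>1 C\<^sub>1)"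
      by (rule central_desargues[where a = "join Z B\<^sub>1" and b = axis and c = "join Z C\<^sub>1" and Z = Z
            and B = A and B' = I])
        (use ZB ZC neq nZ axis_line Z_axis I_axis A PZ P Q par Z_neq_I
           line_through_commute[of lines] in auto)
    \<comment> \<open>Second application: triangles \<open>X, P, Q\<close> and
      \<open>B, B\<^sub>1, C\<^sub>1\<close>, with the parallel sides just obtained.\<close>
    show ?thesis
      by (rule central_desargues[where a = axis and b = "join Z B\<^sub>1" and c = "join Z C\<^sub>1" and Z = Z
            and B = P and B' = B\<^sub>1])
        (use ZB ZC neq nZ axis_line Z_axis X B False ZX PZ P Q par PQ in auto)
  qed
  then show ?thesis using Q X by (auto simp: mult_config_def)
qed

text \<open>Desargues needs three distinct lines through \<open>Z\<close>. If
  \<open>C\<^sub>1\<close> lies on \<open>ZB\<^sub>1\<close>, the transfer goes in two moves, via a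
  point \<open>D\<close> off both the axis and \<open>ZB\<^sub>1\<close>.\<close>

lemma mult_config_transfer:
  assumes B1: "B\<^sub>1 \<in> points" "B\<^sub>1 \<notin> axis" and C1: "C\<^sub>1 \<in> points" "C\<^sub>1 \<notin> axis"
    and A: "A \<in> axis" "A \<noteq> Z" and B: "B \<in> axis"
    and cfg: "mult_config B\<^sub>1 A B P X"
  shows "\<exists>Q. mult_config C\<^sub>1 A B Q X"
proof (cases "C\<^sub>1 \<in> join Z B\<^sub>1")
  case False
  then show ?thesis using mult_config_transfer_generic assms by blast
next
  case True
  obtain D where D: "D \<in> points" "D \<notin> axis" "D \<notin> join Z B\<^sub>1"
    using ex_point_off_joins[OF Z_point I_point B1(1) Z_neq_I B1(2)] by blast
  have "C\<^sub>1 \<notin> join Z D"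
  proof
    assume "C\<^sub>1 \<in> join Z D"
    then have "join Z D = join Z B\<^sub>1"
      using line_eqI[of "join Z D" "join Z B\<^sub>1" Z C\<^sub>1] True C1 Z_axis
        off_axis[OF D(1,2) Z_axis] off_axis[OF B1 Z_axis] by auto
    then show False using D off_axis[OF D(1,2) Z_axis] by auto
  qed
  then show ?thesis
    using mult_config_transfer_generic[OF B1 D A B cfg]
      mult_config_transfer_generic[OF D(1,2) C1 _ A B] by blast
qed

section \<open>Left multiplication by a nonzero point as a bijection of the axis\<close>

abbreviation times :: "'p \<Rightarrow> 'p \<Rightarrow> 'p" where
  "times \<equiv> point_mult points lines Z I"

text \<open>The description in \<open>point_mult\<close> ranges over all auxiliary points; by the
  transfer lemma they give one value, so a single figure determines the product.\<close>

lemma point_mult_eq: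
  assumes B1: "B\<^sub>1 \<in> points" "B\<^sub>1 \<notin> axis" and A: "A \<in> axis" "A \<noteq> Z" and B: "B \<in> axis"
    and cfg: "mult_config B\<^sub>1 A B P X"
  shows "times A B = X"
  unfolding point_mult_def
proof (rule the_equality)
  show "\<exists>B\<^sub>1\<in>points - axis. X = mult_via lines Z I B\<^sub>1 A B"
    using mult_via_eq[OF B1 A(1) B cfg] B1 by auto
next
  fix C assume "\<exists>B\<^sub>1\<in>points - axis. C = mult_via lines Z I B\<^sub>1 A B"
  then obtain C\<^sub>1 where C1: "C\<^sub>1 \<in> points" "C\<^sub>1 \<notin> axis" "C = mult_via lines Z I C\<^sub>1 A B" by auto
  then obtain Q where "mult_config C\<^sub>1 A B Q X"
    using mult_config_transfer[OF B1 C1(1,2) A B cfg] by blast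
  then show "C = X" using mult_via_eq[OF C1(1,2) A(1) B] C1(3) by simp
qed

text \<open>The second factor and the product may differ between the two figures: \<open>P\<close>
  is already fixed by the direction of \<open>AP\<close> and the line
  \<open>ZB\<^sub>1\<close>.\<close>

lemma mult_config_unique_foot:
  assumes B1: "B\<^sub>1 \<in> points" "B\<^sub>1 \<notin> axis" and A: "A \<in> axis" "A \<noteq> Z"
    and cfg: "mult_config B\<^sub>1 A B P X" "mult_config B\<^sub>1 A B' P' X'"
  shows "P = P'"
proof -
  note P = mult_config_point[OF B1 cfg(1)] and P' = mult_config_point[OF B1 cfg(2)]
  have "parallel (join A P) (join A P')"
    using cfg off_axis[OF P(1,2) A(1)] off_axis[OF P'(1,2) A(1)] off_axis[OF B1 I_axis]
      parallel_trans parallel_sym unfolding mult_config_def by metis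
  then show ?thesis
    by (intro parallel_joins_eq[where a = axis and b = "join Z B\<^sub>1" and Z = Z and A = A])
      (use cfg A axis_line Z_axis off_axis[OF B1 Z_axis] B1 in \<open>auto simp: mult_config_def\<close>)
qed

text \<open>Both figures share \<open>P\<close>, so \<open>BB\<^sub>1\<close> and
  \<open>B'B\<^sub>1\<close> are parallel to the same line \<open>XP\<close>; as both pass through
  \<open>B\<^sub>1\<close>, they cut the axis in the same point.\<close>

lemma mult_config_cancel:
  assumes B1: "B\<^sub>1 \<in> points" "B\<^sub>1 \<notin> axis" and A: "A \<in> axis" "A \<noteq> Z"
    and B: "B \<in> axis" "B' \<in> axis"
    and cfg: "mult_config B\<^sub>1 A B P X" "mult_config B\<^sub>1 A B' P' X"
  shows "B = B'"
proof -
  have [simp]: "P' = P" using mult_config_unique_foot[OF B1 A cfg] by simp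
  note P = mult_config_point[OF B1 cfg(1)]
  have "X \<in> axis" "parallel (join B B\<^sub>1) (join X P)" "parallel (join X P) (join B' B\<^sub>1)"
    using cfg parallel_sym by (auto simp: mult_config_def)
  then have "parallel (join B B\<^sub>1) (join B' B\<^sub>1)"
    using parallel_trans off_axis_join_line P(1,2) B1 B by metis
  then show ?thesis using off_axis_parallel_eq[OF B1 B] by blast
qed

lemma bij_betw_left_times:
  assumes A: "A \<in> axis" "A \<noteq> Z"
  shows "bij_betw (times A) axis axis"
proof -
  obtain B\<^sub>1 where B1: "B\<^sub>1 \<in> points" "B\<^sub>1 \<notin> axis"
    using ex_point_off_line[OF axis_line] by blast
  have val: "\<exists>P. mult_config B\<^sub>1 A B P (times A B)" if "B \<in> axis" for B
    using ex_mult_config[OF B1 A that] point_mult_eq[OF B1 A that] by blast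
  have "inj_on (times A) axis"
  proof (rule inj_onI)
    fix B B' assume "B \<in> axis" "B' \<in> axis" "times A B = times A B'"
    then show "B = B'" using mult_config_cancel[OF B1 A] val by metis
  qed
  moreover have "times A ` axis = axis"
  proof
    show "times A ` axis \<subseteq> axis" using val by (auto simp: mult_config_def)
    show "axis \<subseteq> times A ` axis"
      using ex_mult_config_factor[OF B1 A] point_mult_eq[OF B1 A] by blast
  qed
  ultimately show ?thesis by (simp add: bij_betw_def)
qed

section \<open>Inverses and the ratio map\<close>

lemma ex_two_sided_inverse:
  assumes B: "B \<in> axis" "B \<noteq> Z"
  shows "\<exists>Y\<in>axis. Y \<noteq> Z \<and> times B Y = I \<and> times Y B = I"
proof -
  obtain B\<^sub>1 where B1: "B\<^sub>1 \<in> points" "B\<^sub>1 \<notin> axis"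
    using ex_point_off_line[OF axis_line] by blast
  obtain P Y where Y: "Y \<in> axis" and cfg: "mult_config B\<^sub>1 B Y P I"
    using ex_mult_config_factor[OF B1 B I_axis] by blast
  note P = mult_config_point[OF B1 cfg]
  have PZ: "P \<in> join Z B\<^sub>1" and par: "parallel (join B P) (join I B\<^sub>1)" "parallel (join I P) (join Y B\<^sub>1)"
    using cfg by (auto simp: mult_config_def)
  \<comment> \<open>Needed to use \<open>Y\<close> as a left factor. If \<open>Y = Z\<close>, the
    lines \<open>IP\<close> and \<open>ZB\<^sub>1\<close> would be parallel with common point
    \<open>P\<close>, hence equal, putting \<open>I\<close> on \<open>ZB\<^sub>1\<close>.\<close>
  have nZ: "Y \<noteq> Z"
  proof
    assume "Y = Z"
    then have "join I P = join Z B\<^sub>1"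
      using parallel_meet_eq[OF par(2), of P] PZ off_axis[OF P(1,2) I_axis] by simp
    then show False
      using off_axis_meet[OF B1 Z_axis I_axis] off_axis[OF P(1,2) I_axis] Z_neq_I by auto
  qed
  have "join Z P = join Z B\<^sub>1" using off_axis[OF B1 Z_axis] PZ P by (intro join_eqI) auto
  \<comment> \<open>Exchanging \<open>P\<close> with \<open>B\<^sub>1\<close> and \<open>B\<close>
    with \<open>Y\<close> swaps the two parallelism conditions of the figure.\<close>
  then have "mult_config P Y B B\<^sub>1 I"
    using B1 I_axis off_axis[OF B1 Z_axis] par parallel_sym by (auto simp: mult_config_def)
  then have "times Y B = I" using point_mult_eq[OF P(1,2) Y nZ B(1)] by blast
  moreover have "times B Y = I" using point_mult_eq[OF B1 B Y cfg] .
  ultimately show ?thesis using Y nZ by blast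
qed

text \<open>\<open>m_inv\<close> is a definite description of a two-sided inverse. Its uniqueness
  comes from injectivity of left multiplication by \<open>B\<close>; that it differs from
  \<open>Z\<close> makes left multiplication by it bijective.\<close>

lemma line_ring_inverse:
  assumes B: "B \<in> axis" "B \<noteq> Z"
  shows "inv\<^bsub>line_ring points lines Z I\<^esub> B \<in> axis - {Z}"
proof -
  obtain Y where Y: "Y \<in> axis" "Y \<noteq> Z" "times B Y = I" "times Y B = I"
    using ex_two_sided_inverse[OF B] by blast
  have uniq: "y = Y" if "y \<in> axis" "times B y = I" for y
    using inj_onD[OF bij_betw_imp_inj_on[OF bij_betw_left_times[OF B]], of y Y] that Y by simp
  have "inv\<^bsub>line_ring points lines Z I\<^esub> B = Y"
    unfolding m_inv_def line_ring_def
    by (rule the_equality) (simp_all add: Y uniq)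
  then show ?thesis using Y by simp
qed

end

theorem theorem5:
  fixes points :: "'p set" and lines :: "'p set set" and Z I B :: 'p
  assumes "desargues_affine_plane points lines"
    and "Z \<in> points" and "I \<in> points" and "Z \<noteq> I"
    and "B \<in> line_through lines Z I" and "B \<noteq> Z"
  shows "bij_betw (\<lambda>X. ratio points lines Z I X B) (line_through lines Z I) (line_through lines Z I)"
proof -
  interpret desargues_frame points lines Z I
    using assms by (simp add: desargues_frame_def desargues_frame_axioms_def)
  show ?thesis
    using bij_betw_left_times line_ring_inverse[OF assms(5,6)]
    by (simp add: ratio_def line_ring_def)
qed

end
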